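(* Let $S_1$ and $S_2$ be positive affine semigroups in $\mathbb{N}^d$ and let $\kappa$ be a field. Then $S_1$ and $S_2$ can be glued if and only if there are $a,b\in\mathbb{N}$ and a non-zero element in $aS_1\cap bS_2$ generating the group $\mathrm{Grp}(aS_1)\cap\mathrm{Grp}(bS_2)$ in $\mathbb{Z}^d$.
   Context: $\mathbb{N}$ is the set of non-negative integers. An affine semigroup in $\mathbb{N}^d$ is a finitely generated submonoid (containing $0$) of $\mathbb{N}^d$; positive means $0$ is the only invertible element. $aS=\{as:s\in S\}$. $\mathrm{Grp}(S)=\{s-t:s,t\in S\}\subseteq\mathbb{Z}^d$. For $S\subseteq\mathbb{N}^d$, $\kappa[\mathbf{u}^S]$ is the $\kappa$-subalgebra of $\kappa[u_1,\dots,u_d]$ spanned by the monomials $\mathbf{u}^s$, $s\in S$. Gluing. Let $S_1=\langle s_1,\dots,s_n\rangle$ and $S_2=\langle t_1,\dots,t_m\rangle$. $S_1$ and $S_2$ can be glued if there exist positive integers $a,b$ such that the $\kappa$-algebra homomorphisms $\varphi_1:\kappa[X_1,\dots,X_n]\to\kappa[\mathbf{u}^{aS_1}]$, $\varphi_2:\kappa[Y_1,\dots,Y_m]\to\kappa[\mathbf{u}^{bS_2}]$, $\varphi:\kappa[X_1,\dots,X_n,Y_1,\dots,Y_m]\to\kappa[\mathbf{u}^{aS_1+bS_2}]$ given by $\varphi(X_i)=\varphi_1(X_i)=\mathbf{u}^{as_i}$ and $\varphi(Y_j)=\varphi_2(Y_j)=\mathbf{u}^{bt_j}$ satisfy $$\ker\varphi=\ker\varphi_1+\ker\varphi_2+\langle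 X_1^{i_1}\cdots X_n^{i_n}-Y_1^{j_1}\cdots Y_m^{j_m}\rangle$$ (ideals of $\kappa[X_1,\dots,X_n,Y_1,\dots,Y_m]$, where $\ker\varphi_1,\ker\varphi_2$ stand for the ideals they generate) for some monomials $X_1^{i_1}\cdots X_n^{i_n}$ and $Y_1^{j_1}\cdots Y_m^{j_m}$ whose common image under $\varphi$ is different from $1$. *)

theory Defs
  imports "HOL-Analysis.Finite_Cartesian_Product" "HOL-Library.Poly_Mapping" "HOL-Library.Set_Algebras"
begin

section \<open>Affine semigroups\<close>

definition submonoid :: "'a::comm_monoid_add set \<Rightarrow> bool"
  where "submonoid S \<longleftrightarrow> 0 \<in> S \<and> (\<forall>x\<in>S. \<forall>y\<in>S. x + y \<in> S)"

lemma submonoid_submonoid_hull: "submonoid (submonoid hull A)"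
  by (rule hull_in) (auto simp: submonoid_def)

definition affine_semigroup :: "(nat ^ 'd) set \<Rightarrow> bool"
  where "affine_semigroup S \<longleftrightarrow> submonoid S \<and> (\<exists>A. finite A \<and> S = submonoid hull A)"

definition positive_semigroup :: "'a::comm_monoid_add set \<Rightarrow> bool"
  where "positive_semigroup S \<longleftrightarrow> (\<forall>x\<in>S. (\<exists>y\<in>S. x + y = 0) \<longrightarrow> x = 0)"

definition int_vec :: "nat ^ 'd \<Rightarrow> int ^ 'd"
  where "int_vec x = (\<chi> i. int (x $ i))"

definition Grp :: "(nat ^ 'd) set \<Rightarrow> (int ^ 'd) set"
  where "Grp S = {int_vec x - int_vec y | x y. x \<in> S \<and> y \<in> S}"

section \<open>Polynomial rings\<close>

text \<open>
  The polynomial ring over \<open>'k\<close> whose variables are indexed by the finite type \<open>'v\<close>: a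
  polynomial is the finitely supported function that sends an exponent vector to its coefficient,
  with the convolution product of \<^typ>\<open>'a \<Rightarrow>\<^sub>0 'b\<close>.
\<close>

type_synonym ('v, 'k) mpoly = "(nat ^ 'v) \<Rightarrow>\<^sub>0 'k"

definition monomial :: "nat ^ 'v \<Rightarrow> ('v::finite, 'k::field) mpoly"
  where "monomial e = Poly_Mapping.single e 1"

definition Const :: "'k \<Rightarrow> ('v::finite, 'k::field) mpoly"
  where "Const c = Poly_Mapping.single 0 c"

definition Var :: "'v \<Rightarrow> ('v::finite, 'k::field) mpoly"
  where "Var v = monomial (axis v 1)"

text \<open>The \<open>'k\<close>-algebra homomorphism given on the variables by \<open>f\<close>; see \<open>subst_unique\<close> below.\<close>

definition subst :: "('v \<Rightarrow> ('w, 'k) mpoly) \<Rightarrow> ('v::finite, 'k::field) mpoly \<Rightarrow> ('w::finite, 'k) mpoly"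
  where "subst f p = (\<Sum>e\<in>Poly_Mapping.keys p. Const (Poly_Mapping.lookup p e) * (\<Prod>v\<in>UNIV. f v ^ (e $ v)))"

definition algebra_hom :: "(('v::finite, 'k::field) mpoly \<Rightarrow> ('w::finite, 'k) mpoly) \<Rightarrow> bool"
  where "algebra_hom h \<longleftrightarrow>
    (\<forall>p q. h (p + q) = h p + h q) \<and> (\<forall>p q. h (p * q) = h p * h q) \<and> (\<forall>c. h (Const c) = Const c)"

definition semigroup_algebra :: "(nat ^ 'd) set \<Rightarrow> ('d::finite, 'k::field) mpoly set"
  where "semigroup_algebra S = {p. Poly_Mapping.keys p \<subseteq> S}"

definition ker :: "('a \<Rightarrow> 'b::zero) \<Rightarrow> 'a set"
  where "ker h = {p. h p = 0}"

lemma module_times: "module ((*) :: 'a::comm_ring_1 \<Rightarrow> 'a \<Rightarrow> 'a)"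
  by standard (auto simp: algebra_simps)

text \<open>A commutative ring is a module over itself, and the submodules are the ideals.\<close>

definition ideal_generated :: "'a::comm_ring_1 set \<Rightarrow> 'a set"
  where "ideal_generated = module.span (*)"

subsection \<open>The homomorphism given on the variables\<close>

lemma Const_0 [simp]: "Const 0 = 0" and Const_1 [simp]: "Const 1 = 1"
  by (simp_all add: Const_def)

lemma Const_add: "Const (a + b) = Const a + Const b"
  by (simp add: Const_def single_add)

lemma Const_mult: "Const (a * b) = Const a * Const b"
  by (simp add: Const_def mult_single)

lemma Const_times_monomial: "Const c * monomial e = Poly_Mapping.single e c"
  by (simp add: Const_def monomial_def mult_single)

lemma monomial_0 [simp]: "monomial 0 = 1"
  by (simp add: monomial_def)

lemma monomial_add: "monomial (e + f) = monomial e * monomial f"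
  by (simp add: monomial_def mult_single)

lemma monomial_sum: "monomial (sum e A) = (\<Prod>i\<in>A. monomial (e i))"
  by (induction A rule: infinite_finite_induct) (auto simp: monomial_add)

lemma monomial_scale: "monomial (n *s e) = monomial e ^ n"
proof (induction n)
  case 0
  then show ?case by simp
next
  case (Suc n)
  have "Suc n *s e = e + n *s e" by (simp add: vec_eq_iff)
  then show ?case using Suc by (simp add: monomial_add)
qed

lemma monomial_eq_prod_Var: "monomial e = (\<Prod>v\<in>UNIV. Var v ^ (e $ v))"
proof -
  have "e = (\<Sum>v\<in>UNIV. (e $ v) *s axis v 1)"
    by (simp add: vec_eq_iff axis_def if_distrib cong: if_cong)
  then have "monomial e = (\<Prod>v\<in>UNIV. monomial ((e $ v) *s axis v 1))"
    by (metis (no_types) monomial_sum)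
  then show ?thesis by (simp add: monomial_scale Var_def)
qed

lemma mpoly_eq_sum: "p = (\<Sum>e\<in>Poly_Mapping.keys p. Const (Poly_Mapping.lookup p e) * monomial e)"
  unfolding Const_times_monomial
  by (rule poly_mapping_eqI) (simp add: lookup_sum lookup_single when_def in_keys_iff)

lemma subst_superset:
  assumes "finite A" "Poly_Mapping.keys p \<subseteq> A"
  shows "subst f p = (\<Sum>e\<in>A. Const (Poly_Mapping.lookup p e) * (\<Prod>v\<in>UNIV. f v ^ (e $ v)))"
  unfolding subst_def
  by (rule sum.mono_neutral_left) (use assms in \<open>auto simp: in_keys_iff\<close>)

lemma subst_add: "subst f (p + q) = subst f p + subst f q"
  by (simp add: subst_superset[of "Poly_Mapping.keys p \<union> Poly_Mapping.keys q"] keys_add lookup_add Const_add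
      distrib_right sum.distrib)

lemma subst_0 [simp]: "subst f 0 = 0"
  by (simp add: subst_def)

lemma subst_sum: "subst f (sum g A) = (\<Sum>x\<in>A. subst f (g x))"
  by (induction A rule: infinite_finite_induct) (auto simp: subst_add)

lemma subst_single: "subst f (Poly_Mapping.single e c) = Const c * (\<Prod>v\<in>UNIV. f v ^ (e $ v))"
  by (simp add: subst_superset[of "{e}"])

lemma subst_mult: "subst f (p * q) = subst f p * subst f q"
proof -
  have single: "subst f (Poly_Mapping.single d a * Poly_Mapping.single e b) =
      subst f (Poly_Mapping.single d a) * subst f (Poly_Mapping.single e b)" for d e a b
    by (simp add: mult_single subst_single Const_mult power_add prod.distrib mult_ac)
  have "subst f (p * q) = subst f ((\<Sum>d\<in>Poly_Mapping.keys p. Poly_Mapping.single d (Poly_Mapping.lookup p d)) *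
      (\<Sum>e\<in>Poly_Mapping.keys q. Poly_Mapping.single e (Poly_Mapping.lookup q e)))"
    using mpoly_eq_sum[of p] mpoly_eq_sum[of q] unfolding Const_times_monomial by simp
  also have "\<dots> = subst f (\<Sum>d\<in>Poly_Mapping.keys p. Poly_Mapping.single d (Poly_Mapping.lookup p d)) *
      subst f (\<Sum>e\<in>Poly_Mapping.keys q. Poly_Mapping.single e (Poly_Mapping.lookup q e))"
    by (simp add: sum_product subst_sum single)
  also have "\<dots> = subst f p * subst f q"
    using mpoly_eq_sum[of p] mpoly_eq_sum[of q] unfolding Const_times_monomial by simp
  finally show ?thesis .
qed

lemma subst_Const: "subst f (Const c) = Const c"
  by (subst Const_def) (simp add: subst_single)

lemma algebra_hom_subst: "algebra_hom (subst f)"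
  by (simp add: algebra_hom_def subst_add subst_mult subst_Const)

lemma subst_Var: "subst f (Var v) = f v"
proof -
  have "(\<Prod>w\<in>UNIV. f w ^ (axis v (1::nat) $ w)) = (\<Prod>w\<in>UNIV. if w = v then f w else 1)"
    by (rule prod.cong) (auto simp: axis_def)
  then show ?thesis
    by (simp add: Var_def monomial_def subst_single)
qed

lemma subst_unique:
  assumes "algebra_hom h" "\<And>v. h (Var v) = f v"
  shows "h = subst f"
proof
  fix p
  have add: "h (p + q) = h p + h q" and mult: "h (p * q) = h p * h q"
    and const: "h (Const c) = Const c" for p q c
    using assms(1) by (auto simp: algebra_hom_def)
  have zero: "h 0 = 0" and one: "h 1 = 1" using const[of 0] const[of 1] by simp_all
  have sum: "h (sum g A) = (\<Sum>x\<in>A. h (g x))" for g and A :: "(nat ^ 'a) set"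
    by (induction A rule: infinite_finite_induct) (auto simp: add zero)
  have prod: "h (prod g A) = (\<Prod>x\<in>A. h (g x))" for g and A :: "'a set"
    by (induction A rule: infinite_finite_induct) (auto simp: mult one)
  have power: "h (q ^ n) = h q ^ n" for q n
    by (induction n) (auto simp: mult one)
  have "h p = h (\<Sum>e\<in>Poly_Mapping.keys p. Const (Poly_Mapping.lookup p e) * monomial e)"
    using mpoly_eq_sum[of p] by simp
  then show "h p = subst f p"
    by (simp add: sum mult const monomial_eq_prod_Var prod power assms(2) subst_def)
qed

lemma range_subst_monomial:
  fixes s :: "'v::finite \<Rightarrow> nat ^ 'd::finite"
  shows "range (subst (\<lambda>v. monomial (s v))) \<subseteq> semigroup_algebra (submonoid hull range s)"
proof safe
  fix p
  have zero: "0 \<in> submonoid hull range s"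
    and add: "\<lbrakk>x \<in> submonoid hull range s; y \<in> submonoid hull range s\<rbrakk>
      \<Longrightarrow> x + y \<in> submonoid hull range s" for x y
    using submonoid_submonoid_hull[of "range s"] by (simp_all only: submonoid_def[of "_ hull _"])
  have mem: "s v \<in> submonoid hull range s" for v
    by (rule hull_inc) simp
  have scale: "n *s x \<in> submonoid hull range s" if x: "x \<in> submonoid hull range s" for n x
  proof (induction n)
    case 0
    show ?case using zero by simp
  next
    case (Suc n)
    have "Suc n *s x = x + n *s x" by (simp add: vec_eq_iff)
    then show ?case using Suc x add by simp
  qed
  have sum: "sum g A \<in> submonoid hull range s" if "\<And>v. g v \<in> submonoid hull range s"
    for g and A :: "'v set"
    by (induction A rule: infinite_finite_induct) (use that zero add in auto)
  have eq: "subst (\<lambda>v. monomial (s v)) p =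
      (\<Sum>e\<in>Poly_Mapping.keys p. Poly_Mapping.single (\<Sum>v\<in>UNIV. (e $ v) *s s v) (Poly_Mapping.lookup p e))"
    by (simp add: subst_def monomial_scale[symmetric] monomial_sum[symmetric] Const_times_monomial)
  have "Poly_Mapping.keys (subst (\<lambda>v. monomial (s v)) p) \<subseteq>
      (\<Union>e\<in>Poly_Mapping.keys p. Poly_Mapping.keys (Poly_Mapping.single (\<Sum>v\<in>UNIV. (e $ v) *s s v) (Poly_Mapping.lookup p e)))"
    unfolding eq by (rule Poly_Mapping.keys_sum)
  also have "\<dots> \<subseteq> submonoid hull range s"
    by (auto split: if_splits intro!: sum scale mem)
  finally show "subst (\<lambda>v. monomial (s v)) p \<in> semigroup_algebra (submonoid hull range s)"
    by (simp add: semigroup_algebra_def)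
qed

section \<open>Gluing\<close>

text \<open>
  For the generators \<open>s\<close> and \<open>t\<close> and the field \<open>'k\<close>. The ring \<open>('n + 'm, 'k) mpoly\<close> has the
  variables \<open>X i = Var (Inl i)\<close> and \<open>Y j = Var (Inr j)\<close>. The homomorphisms are regarded as maps
  into the polynomial ring that contains the semigroup algebras (see \<open>range_subst_monomial\<close>),
  which does not change their kernels.
\<close>

definition can_be_glued ::
    "'k::field itself \<Rightarrow> ('n::finite \<Rightarrow> nat ^ 'd::finite) \<Rightarrow> ('m::finite \<Rightarrow> nat ^ 'd) \<Rightarrow> bool"
  where "can_be_glued _ s t \<longleftrightarrow> (\<exists>a b. a > 0 \<and> b > 0 \<and>
    (let \<phi>1 = subst (\<lambda>i. monomial (a *s s i)) :: ('n, 'k) mpoly \<Rightarrow> ('d, 'k) mpoly;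
         \<phi>2 = subst (\<lambda>j. monomial (b *s t j)) :: ('m, 'k) mpoly \<Rightarrow> ('d, 'k) mpoly;
         \<phi> = subst (case_sum (\<lambda>i. monomial (a *s s i)) (\<lambda>j. monomial (b *s t j)))
               :: ('n + 'm, 'k) mpoly \<Rightarrow> ('d, 'k) mpoly;
         \<iota>1 = subst (\<lambda>i. Var (Inl i)) :: ('n, 'k) mpoly \<Rightarrow> ('n + 'm, 'k) mpoly;
         \<iota>2 = subst (\<lambda>j. Var (Inr j)) :: ('m, 'k) mpoly \<Rightarrow> ('n + 'm, 'k) mpoly
     in \<exists>e f. \<phi> (\<iota>1 (monomial e)) = \<phi> (\<iota>2 (monomial f)) \<and> \<phi> (\<iota>1 (monomial e)) \<noteq> 1 \<and>
          ker \<phi> = ideal_generated (\<iota>1 ` ker \<phi>1) + ideal_generated (\<iota>2 ` ker \<phi>2)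
                    + ideal_generated {\<iota>1 (monomial e) - \<iota>2 (monomial f)}))"

end

theory Submission
  imports Defs
begin

text \<open>
  Write \<open>A e = \<Sum> e\<^sub>i a s\<^sub>i\<close> and \<open>B f = \<Sum> f\<^sub>j b t\<^sub>j\<close> for the degrees of the monomials \<open>X\<^sup>e\<close> and
  \<open>Y\<^sup>f\<close>, so that \<open>\<phi>\<close> sends \<open>X\<^sup>e Y\<^sup>f\<close> to the monomial with exponent \<open>A e + B f\<close>. The semigroups
  \<open>a S\<^sub>1\<close> and \<open>b S\<^sub>2\<close> are the ranges of \<open>A\<close> and \<open>B\<close>, so an element \<open>g\<close> of both is a common degree
  \<open>A e\<^sub>0 = B f\<^sub>0\<close>, that is, a choice of two monomials with the same image under \<open>\<phi>\<close>. This image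
  differs from \<open>1\<close> if and only if \<open>g \<noteq> 0\<close>, and then \<open>a\<close> and \<open>b\<close> are positive. It remains to see,
  for fixed \<open>a\<close>, \<open>b\<close>, \<open>e\<^sub>0\<close>, \<open>f\<^sub>0\<close>, that the ideal \<open>J\<close> generated by the two kernels and by the
  difference of the two monomials is the kernel of \<open>\<phi>\<close> exactly when \<open>g\<close> generates the
  intersection of the two groups (\<open>ker_eq_gluing_ideal_iff\<close>). Always \<open>J \<subseteq> ker \<phi>\<close>.

  Suppose that \<open>g\<close> generates the intersection. The kernel of \<open>\<phi>\<close> is linearly spanned by
  differences of monomials of the same degree (\<open>ker_subset_if_binomials\<close>). If
  \<open>A e + B f = A e' + B f'\<close>, then \<open>A e - A e' = B f' - B f\<close> lies in both groups, hence equals \<open>k g\<close>,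
  where \<open>k \<ge> 0\<close> without loss of generality. So \<open>A e = A (e' + k e\<^sub>0)\<close> and \<open>B f' = B (f + k f\<^sub>0)\<close>, and
  modulo \<open>J\<close> the factor with exponent \<open>k e\<^sub>0\<close> of \<open>X\<close> can be traded for the one with exponent
  \<open>k f\<^sub>0\<close> of \<open>Y\<close> (\<open>binomial_in_gluing_ideal\<close>).

  Conversely, suppose that \<open>J = ker \<phi>\<close>. Send the monomial \<open>X\<^sup>e Y\<^sup>f\<close> to the class of \<open>A e\<close> in the
  quotient of \<open>\<int>\<^sup>d\<close> by \<open>\<int> g\<close>, forgetting \<open>Y\<close>. This induces a homomorphism to the group algebra of
  the quotient that annihilates all generators of \<open>J\<close>. An element \<open>A e - A e' = B f' - B f\<close> of both
  groups gives a binomial in the kernel of \<open>\<phi>\<close>, so \<open>A e\<close> and \<open>A e'\<close> have the same class. In the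
  formal proof the group algebra is replaced by its coordinate functionals: the linear extension
  of the indicator function of one coset (\<open>coset_functional_gluing_ideal\<close>).
\<close>

section \<open>Degrees\<close>

definition degree :: "('v::finite \<Rightarrow> nat ^ 'd) \<Rightarrow> nat ^ 'v \<Rightarrow> nat ^ 'd"
  where "degree s e = (\<Sum>v\<in>UNIV. (e $ v) *s s v)"

lemma degree_0 [simp]: "degree s 0 = 0"
  by (simp add: degree_def vec_eq_iff)

lemma degree_zero_weights [simp]: "degree (\<lambda>_. 0) e = 0"
  by (simp add: degree_def vec_eq_iff)

lemma degree_add: "degree s (e + f) = degree s e + degree s f"
  by (simp add: degree_def vec_eq_iff sum.distrib algebra_simps)

lemma degree_scale: "degree s (n *s e) = n *s degree s e"
  by (simp add: degree_def vec_eq_iff sum_distrib_left mult.assoc)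

lemma degree_scale_weights: "degree (\<lambda>v. n *s s v) e = n *s degree s e"
  by (simp add: degree_def vec_eq_iff sum_distrib_left mult.left_commute)

lemma degree_axis: "degree s (axis v 1) = s v"
proof -
  have "degree s (axis v 1) = (\<Sum>w\<in>UNIV. if w = v then s w else 0)"
    unfolding degree_def by (rule sum.cong) (auto simp: axis_def vec_eq_iff)
  then show ?thesis by simp
qed

lemma submonoid_hull_range: "submonoid hull range s = range (degree s)"
  for s :: "'v::finite \<Rightarrow> nat ^ 'd"
proof (rule hull_unique)
  show "range s \<subseteq> range (degree s)"
    using degree_axis by (metis image_subsetI rangeI)
  show "submonoid (range (degree s))"
    by (auto simp: submonoid_def image_iff) (metis degree_0, metis degree_add)
next
  fix T assume T: "range s \<subseteq> T" "submonoid T"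
  have scale: "n *s x \<in> T" if "x \<in> T" for n x
  proof (induction n)
    case 0
    then show ?case using T(2) by (simp add: submonoid_def)
  next
    case (Suc n)
    have "Suc n *s x = x + n *s x" by (simp add: vec_eq_iff)
    then show ?case using Suc that T(2) by (simp add: submonoid_def)
  qed
  have "(\<Sum>v\<in>V. (e $ v) *s s v) \<in> T" for e :: "nat ^ 'v" and V
    by (induction V rule: infinite_finite_induct) (use T scale in \<open>auto simp: submonoid_def image_subset_iff\<close>)
  then show "range (degree s) \<subseteq> T"
    by (auto simp: degree_def)
qed

lemma scale_image_range_degree: "(*s) n ` range (degree s) = range (degree (\<lambda>v. n *s s v))"
  by (auto simp: degree_scale_weights)

lemma int_vec_add: "int_vec (x + y) = int_vec x + int_vec y"
  by (simp add: int_vec_def vec_eq_iff)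

lemma int_vec_scale: "int_vec (n *s x) = int n *s int_vec x"
  by (simp add: int_vec_def vec_eq_iff)

lemma int_vec_eq_iff [simp]: "int_vec x = int_vec y \<longleftrightarrow> x = y"
  by (simp add: int_vec_def vec_eq_iff)

text \<open>
  An integer multiple is a difference of two multiples by natural numbers, one of which is zero.
\<close>

lemma multiple_in_Grp: "k *s int_vec (degree s e) \<in> Grp (range (degree s))"
proof -
  have "k *s int_vec (degree s e) = int_vec (degree s (nat k *s e)) - int_vec (degree s (nat (- k) *s e))"
    by (simp add: degree_scale int_vec_scale vec_eq_iff)
  then show ?thesis by (auto simp: Grp_def)
qed

section \<open>Linear extensions\<close>

text \<open>
  The linear map that is \<open>F\<close> on the monomials. Its values are polynomials, so that it serves both as a
  device that rewrites polynomials and, when \<open>F\<close> takes only the values \<open>0\<close> and \<open>1\<close>, as a linear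
  functional.
\<close>

definition lin_ext :: "(nat ^ 'v \<Rightarrow> ('w, 'k) mpoly) \<Rightarrow> ('v::finite, 'k::field) mpoly \<Rightarrow> ('w::finite, 'k) mpoly"
  where "lin_ext F p = (\<Sum>e\<in>Poly_Mapping.keys p. Const (Poly_Mapping.lookup p e) * F e)"

lemma lin_ext_superset:
  assumes "finite A" "Poly_Mapping.keys p \<subseteq> A"
  shows "lin_ext F p = (\<Sum>e\<in>A. Const (Poly_Mapping.lookup p e) * F e)"
  unfolding lin_ext_def
  by (rule sum.mono_neutral_left) (use assms in \<open>auto simp: in_keys_iff\<close>)

lemma lin_ext_add: "lin_ext F (p + q) = lin_ext F p + lin_ext F q"
  by (simp add: lin_ext_superset[of "Poly_Mapping.keys p \<union> Poly_Mapping.keys q"] keys_add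
      lookup_add Const_add distrib_right sum.distrib)

lemma lin_ext_0 [simp]: "lin_ext F 0 = 0"
  by (simp add: lin_ext_def)

lemma lin_ext_Const_monomial: "lin_ext F (Const c * monomial e) = Const c * F e"
  by (simp add: lin_ext_superset[of "{e}"] Const_times_monomial)

lemma lin_ext_monomial: "lin_ext F (monomial e) = F e"
  using lin_ext_Const_monomial[of F 1 e] by simp

lemma lin_ext_diff: "lin_ext F (p - q) = lin_ext F p - lin_ext F q"
  using lin_ext_add[of F "p - q" q] by simp

text \<open>This reduces identities between linear maps to their values on monomials.\<close>

lemma linear_eq_lin_ext:
  assumes add: "\<And>p q. L (p + q) = L p + L q"
    and Const: "\<And>c e. L (Const c * monomial e) = Const c * F e"
  shows "L = lin_ext F"
proof
  fix p
  have "L 0 = 0" using add[of 0 0] by simp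
  then have "L (sum g A) = (\<Sum>x\<in>A. L (g x))" for g and A :: "(nat ^ 'a) set"
    by (induction A rule: infinite_finite_induct) (auto simp: add)
  then show "L p = lin_ext F p"
    by (subst mpoly_eq_sum[of p]) (simp add: Const lin_ext_def)
qed

lemma subst_eq_lin_ext: "subst (\<lambda>v. monomial (s v)) = lin_ext (\<lambda>e. monomial (degree s e))"
  by (rule ext)
    (simp add: subst_def lin_ext_def degree_def monomial_scale[symmetric] monomial_sum[symmetric])

lemma subst_monomial: "subst (\<lambda>v. monomial (s v)) (monomial e) = monomial (degree s e)"
  by (simp add: subst_eq_lin_ext lin_ext_monomial)

text \<open>
  A linear map that sees monomials only through their degree factors through the monomial
  homomorphism, and so kills its kernel.
\<close>

lemma lin_ext_degree:
  "lin_ext (\<lambda>e. F (degree s e)) p = lin_ext F (subst (\<lambda>v. monomial (s v)) p)"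
proof -
  have "(\<lambda>p. lin_ext F (subst (\<lambda>v. monomial (s v)) p)) = lin_ext (\<lambda>e. F (degree s e))"
    by (rule linear_eq_lin_ext)
      (simp_all add: subst_add lin_ext_add subst_mult subst_Const subst_monomial lin_ext_Const_monomial)
  then show ?thesis by (rule fun_cong[symmetric])
qed

lemma lin_ext_monomial_mult: "lin_ext F (monomial h * p) = lin_ext (\<lambda>e. F (h + e)) p"
proof -
  have "(\<lambda>p. lin_ext F (monomial h * p)) = lin_ext (\<lambda>e. F (h + e))"
    by (rule linear_eq_lin_ext)
      (simp_all add: distrib_left lin_ext_add mult.left_commute[of "monomial h"] monomial_add[symmetric]
        lin_ext_Const_monomial)
  then show ?thesis by (rule fun_cong)
qed

section \<open>Ideals\<close>

lemmas ideal_base = module.span_base[OF module_times, folded ideal_generated_def]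
  and ideal_add = module.span_add[OF module_times, folded ideal_generated_def]
  and ideal_mult = module.span_scale[OF module_times, folded ideal_generated_def]
  and ideal_neg = module.span_neg[OF module_times, folded ideal_generated_def]
  and ideal_sum = module.span_sum[OF module_times, folded ideal_generated_def]

lemma ideal_generated_Un: "ideal_generated (A \<union> B) = ideal_generated A + ideal_generated B"
  unfolding ideal_generated_def module.span_Un[OF module_times] set_plus_def by auto

text \<open>
  An ideal is spanned, as a vector space, by the products of its generators with monomials, and so
  only these products matter for the vanishing of a linear map.
\<close>

lemma lin_ext_ideal_eq_0:
  assumes "\<And>h q. q \<in> Q \<Longrightarrow> lin_ext F (monomial h * q) = 0" and "p \<in> ideal_generated Q"
  shows "lin_ext F p = 0"
  using assms(2) unfolding ideal_generated_def
proof (induction rule: module.span_induct_alt[OF module_times, consumes 1, case_names base step])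
  case base
  show ?case by simp
next
  case (step c x y)
  have scale: "lin_ext F (Const k * q) = Const k * lin_ext F q" for k q
  proof -
    have "(\<lambda>q. lin_ext F (Const k * q)) = lin_ext (\<lambda>e. Const k * F e)"
      by (rule linear_eq_lin_ext)
        (simp_all add: distrib_left lin_ext_add lin_ext_Const_monomial mult.assoc[symmetric]
          Const_mult[symmetric] mult.commute[of k])
    then have "lin_ext F (Const k * q) = lin_ext (\<lambda>e. Const k * F e) q" by (rule fun_cong)
    also have "\<dots> = Const k * lin_ext F q"
      by (simp add: lin_ext_def sum_distrib_left mult.left_commute)
    finally show ?thesis .
  qed
  \<comment> \<open>The map is linear in \<open>c\<close> for fixed \<open>x\<close>, so it vanishes because it does so for monomials \<open>c\<close>.\<close>
  have "(\<lambda>c. lin_ext F (c * x)) = lin_ext (\<lambda>h. 0)"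
    by (rule linear_eq_lin_ext)
      (use assms(1)[OF step(1)] in \<open>simp_all add: distrib_right lin_ext_add mult.assoc scale\<close>)
  then have "lin_ext F (c * x) = lin_ext (\<lambda>h. 0) c" by (rule fun_cong)
  then have "lin_ext F (c * x) = 0" by (simp add: lin_ext_def)
  then show ?case using step(2) by (simp add: lin_ext_add)
qed

text \<open>
  Replace every monomial by a chosen one of the same degree. This changes a polynomial by an
  element of the ideal, and it sends the kernel to zero because it factors through the degree.
\<close>

lemma ker_subset_if_binomials:
  fixes s :: "'v::finite \<Rightarrow> nat ^ 'd::finite" and Q :: "('v, 'k::field) mpoly set"
  assumes binomials: "\<And>h h'. degree s h = degree s h' \<Longrightarrow> monomial h - monomial h' \<in> ideal_generated Q"
  shows "ker (subst (\<lambda>v. monomial (s v)) :: ('v, 'k) mpoly \<Rightarrow> ('d, 'k) mpoly) \<subseteq> ideal_generated Q"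
proof
  fix p :: "('v, 'k) mpoly"
  assume "p \<in> ker (subst (\<lambda>v. monomial (s v)) :: ('v, 'k) mpoly \<Rightarrow> ('d, 'k) mpoly)"
  then have p: "subst (\<lambda>v. monomial (s v)) p = (0 :: ('d, 'k) mpoly)" by (simp add: ker_def)
  define r where "r w = (SOME h. degree s h = w)" for w
  have r: "degree s h = degree s (r (degree s h))" for h
    unfolding r_def by (rule someI[of "\<lambda>h'. degree s h' = degree s h" h, symmetric]) simp
  have "lin_ext (\<lambda>h. monomial (r (degree s h)) :: ('v, 'k) mpoly) p = 0"
    using lin_ext_degree[of "\<lambda>w. monomial (r w)" s p] p by simp
  then have "p = lin_ext monomial p - lin_ext (\<lambda>h. monomial (r (degree s h))) p"
    using mpoly_eq_sum[of p] by (simp add: lin_ext_def)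
  also have "\<dots> = (\<Sum>h\<in>Poly_Mapping.keys p. Const (Poly_Mapping.lookup p h) *
      (monomial h - monomial (r (degree s h))))"
    by (simp add: lin_ext_def sum_subtractf right_diff_distrib)
  also have "\<dots> \<in> ideal_generated Q"
    using binomials[OF r] by (intro ideal_sum ideal_mult)
  finally show "p \<in> ideal_generated Q" .
qed

section \<open>Two groups of variables\<close>

definition left_exp :: "nat ^ 'n \<Rightarrow> nat ^ ('n::finite + 'm::finite)"
  where "left_exp e = (\<chi> v. case v of Inl i \<Rightarrow> e $ i | Inr j \<Rightarrow> 0)"

definition right_exp :: "nat ^ 'm \<Rightarrow> nat ^ ('n::finite + 'm::finite)"
  where "right_exp f = (\<chi> v. case v of Inl i \<Rightarrow> 0 | Inr j \<Rightarrow> f $ j)"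

lemma exp_eq_left_right: "h = left_exp (\<chi> i. h $ Inl i) + right_exp (\<chi> j. h $ Inr j)"
  by (simp add: vec_eq_iff left_exp_def right_exp_def split: sum.split)

lemma sum_UNIV_Plus:
  "(\<Sum>v\<in>(UNIV :: ('n::finite + 'm::finite) set). f v) = (\<Sum>i\<in>UNIV. f (Inl i)) + (\<Sum>j\<in>UNIV. f (Inr j))"
  by (simp add: UNIV_Plus_UNIV[symmetric] sum.Plus del: UNIV_Plus_UNIV)

lemma degree_left_exp [simp]: "degree s (left_exp e) = degree (\<lambda>i. s (Inl i)) e"
  by (simp add: degree_def sum_UNIV_Plus left_exp_def)

lemma degree_right_exp [simp]: "degree s (right_exp f) = degree (\<lambda>j. s (Inr j)) f"
  by (simp add: degree_def sum_UNIV_Plus right_exp_def)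

lemma degree_Inl: "degree (\<lambda>i. axis (Inl i) 1) e = left_exp e"
  and degree_Inr: "degree (\<lambda>j. axis (Inr j) 1) f = right_exp f"
  by (auto simp: degree_def left_exp_def right_exp_def vec_eq_iff axis_def if_distrib
      split: sum.split cong: if_cong)

abbreviation include_left :: "('n::finite, 'k::field) mpoly \<Rightarrow> ('n + 'm::finite, 'k) mpoly"
  where "include_left \<equiv> subst (\<lambda>i. Var (Inl i))"

abbreviation include_right :: "('m::finite, 'k::field) mpoly \<Rightarrow> ('n::finite + 'm, 'k) mpoly"
  where "include_right \<equiv> subst (\<lambda>j. Var (Inr j))"

lemma include_left_monomial: "include_left (monomial e) = monomial (left_exp e)"
  and include_right_monomial: "include_right (monomial f) = monomial (right_exp f)"
  by (simp_all only: Var_def subst_monomial degree_Inl degree_Inr)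

lemma lin_ext_include_left: "lin_ext F (include_left p) = lin_ext (\<lambda>e. F (left_exp e)) p"
  and lin_ext_include_right: "lin_ext F (include_right q) = lin_ext (\<lambda>f. F (right_exp f)) q"
  by (simp_all only: Var_def lin_ext_degree[symmetric] degree_Inl degree_Inr)

section \<open>The gluing ideal\<close>

definition gluing_generators ::
    "('n::finite \<Rightarrow> nat ^ 'd::finite) \<Rightarrow> ('m::finite \<Rightarrow> nat ^ 'd) \<Rightarrow> nat ^ 'n \<Rightarrow> nat ^ 'm
      \<Rightarrow> ('n + 'm, 'k::field) mpoly set"
  where "gluing_generators s t e f =
    include_left ` ker (subst (\<lambda>i. monomial (s i)) :: ('n, 'k) mpoly \<Rightarrow> ('d, 'k) mpoly) \<union>
    include_right ` ker (subst (\<lambda>j. monomial (t j)) :: ('m, 'k) mpoly \<Rightarrow> ('d, 'k) mpoly) \<union>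
    {monomial (left_exp e) - monomial (right_exp f)}"

text \<open>
  Multiplication by the monomial with exponent \<open>h\<close> shifts the argument of \<open>F\<close> by \<open>h\<close>. A function
  that depends on one group of variables only through its degree factors, on that group, through
  the corresponding homomorphism and so kills its kernel. The lemma is used for the
  degree itself, which gives \<open>J \<subseteq> ker \<phi>\<close>, and for the indicator functions of cosets.
\<close>

lemma lin_ext_gluing_ideal_eq_0:
  fixes F :: "nat ^ ('n::finite + 'm::finite) \<Rightarrow> ('w::finite, 'k::field) mpoly"
  assumes left: "\<And>h. \<exists>G. \<forall>e'. F (h + left_exp e') = G (degree s e')"
    and right: "\<And>h. \<exists>G. \<forall>f'. F (h + right_exp f') = G (degree t f')"
    and trade: "\<And>h. F (h + left_exp e) = F (h + right_exp f)"
    and p: "p \<in> ideal_generated (gluing_generators s t e f)"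
  shows "lin_ext F p = 0"
proof (rule lin_ext_ideal_eq_0[OF _ p])
  fix h and q :: "('n + 'm, 'k) mpoly"
  assume "q \<in> gluing_generators s t e f"
  then consider
    (left) q' where "q = include_left q'" "subst (\<lambda>i. monomial (s i)) q' = 0"
  | (right) q' where "q = include_right q'" "subst (\<lambda>i. monomial (t i)) q' = 0"
  | (binomial) "q = monomial (left_exp e) - monomial (right_exp f)"
    by (auto simp: gluing_generators_def ker_def)
  then show "lin_ext F (monomial h * q) = 0"
  proof cases
    case left
    obtain G where "\<And>e'. F (h + left_exp e') = G (degree s e')" using assms(1) by blast
    then show ?thesis
      using left by (simp add: lin_ext_monomial_mult lin_ext_include_left lin_ext_degree)
  next
    case right
    obtain G where "\<And>f'. F (h + right_exp f') = G (degree t f')" using assms(2) by blast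
    then show ?thesis
      using right by (simp add: lin_ext_monomial_mult lin_ext_include_right lin_ext_degree)
  next
    case binomial
    then show ?thesis
      using trade by (simp add: lin_ext_monomial_mult lin_ext_diff lin_ext_monomial)
  qed
qed

text \<open>
  The homomorphism \<open>\<phi>\<close> is itself the linear extension of a function of the kind just considered.
\<close>

lemma gluing_ideal_subset_ker:
  fixes s :: "'n::finite \<Rightarrow> nat ^ 'd::finite" and t :: "'m::finite \<Rightarrow> nat ^ 'd"
  assumes "degree s e = degree t f"
  shows "ideal_generated (gluing_generators s t e f) \<subseteq>
    ker (subst (\<lambda>v. monomial (case_sum s t v)) :: ('n + 'm, 'k::field) mpoly \<Rightarrow> ('d, 'k) mpoly)"
proof
  fix p :: "('n + 'm, 'k) mpoly"
  assume p: "p \<in> ideal_generated (gluing_generators s t e f)"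
  have "lin_ext (\<lambda>h. monomial (degree (case_sum s t) h) :: ('d, 'k) mpoly) p = 0"
    by (rule lin_ext_gluing_ideal_eq_0[OF _ _ _ p]) (auto simp: degree_add assms)
  then show "p \<in> ker (subst (\<lambda>v. monomial (case_sum s t v)) :: ('n + 'm, 'k) mpoly \<Rightarrow> ('d, 'k) mpoly)"
    by (simp add: ker_def subst_eq_lin_ext)
qed

text \<open>
  The chain of congruences modulo the ideal: change the first exponent within its degree, trade
  \<open>k e\<close> for \<open>k f\<close>, and change the second exponent within its degree.
\<close>

lemma binomial_in_gluing_ideal:
  fixes s :: "'n::finite \<Rightarrow> nat ^ 'd::finite" and t :: "'m::finite \<Rightarrow> nat ^ 'd"
  assumes x: "degree s x = degree s (x' + k *s e)" and y: "degree t y' = degree t (y + k *s f)"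
  shows "(monomial (left_exp x + right_exp y) - monomial (left_exp x' + right_exp y')
    :: ('n + 'm, 'k::field) mpoly) \<in> ideal_generated (gluing_generators s t e f)"
proof -
  define J :: "('n + 'm, 'k) mpoly set" where "J = ideal_generated (gluing_generators s t e f)"
  have add: "p + q \<in> J" if "p \<in> J" "q \<in> J" for p q
    using that unfolding J_def by (rule ideal_add)
  have mult: "c * q \<in> J" if "q \<in> J" for c q
    using that unfolding J_def by (rule ideal_mult)
  have gen: "q \<in> J" if "q \<in> gluing_generators s t e f" for q
    using that unfolding J_def by (rule ideal_base)
  have left: "monomial (left_exp z) - monomial (left_exp z') \<in> J" if "degree s z = degree s z'" for z z'
  proof (rule gen)
    have "monomial z - monomial z' \<in> ker (subst (\<lambda>i. monomial (s i)) :: ('n, 'k) mpoly \<Rightarrow> ('d, 'k) mpoly)"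
      using that by (simp add: ker_def subst_eq_lin_ext lin_ext_diff lin_ext_monomial)
    moreover have "include_left (monomial z - monomial z') =
        (monomial (left_exp z) - monomial (left_exp z') :: ('n + 'm, 'k) mpoly)"
      by (simp only: Var_def subst_eq_lin_ext lin_ext_diff lin_ext_monomial degree_Inl)
    ultimately show "(monomial (left_exp z) - monomial (left_exp z') :: ('n + 'm, 'k) mpoly)
        \<in> gluing_generators s t e f"
      unfolding gluing_generators_def by (metis (no_types, lifting) UnI1 imageI)
  qed
  have right: "monomial (right_exp z) - monomial (right_exp z') \<in> J" if "degree t z = degree t z'" for z z'
  proof (rule gen)
    have "monomial z - monomial z' \<in> ker (subst (\<lambda>j. monomial (t j)) :: ('m, 'k) mpoly \<Rightarrow> ('d, 'k) mpoly)"
      using that by (simp add: ker_def subst_eq_lin_ext lin_ext_diff lin_ext_monomial)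
    moreover have "include_right (monomial z - monomial z') =
        (monomial (right_exp z) - monomial (right_exp z') :: ('n + 'm, 'k) mpoly)"
      by (simp only: Var_def subst_eq_lin_ext lin_ext_diff lin_ext_monomial degree_Inr)
    ultimately show "(monomial (right_exp z) - monomial (right_exp z') :: ('n + 'm, 'k) mpoly)
        \<in> gluing_generators s t e f"
      unfolding gluing_generators_def by (metis (no_types, lifting) UnI1 UnI2 imageI)
  qed
  have scale_exp: "left_exp (n *s z) = n *s left_exp z" "right_exp (n *s z') = n *s right_exp z'"
    and add_exp: "left_exp (z + w) = left_exp z + left_exp w" "right_exp (z' + w') = right_exp z' + right_exp w'"
    for n and z w :: "nat ^ 'n" and z' w' :: "nat ^ 'm"
    by (auto simp: left_exp_def right_exp_def vec_eq_iff split: sum.split)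
  define X :: "nat ^ 'n \<Rightarrow> ('n + 'm, 'k) mpoly" where "X z = monomial (left_exp z)" for z
  define Y :: "nat ^ 'm \<Rightarrow> ('n + 'm, 'k) mpoly" where "Y z = monomial (right_exp z)" for z
  have X_add: "X (z + n *s w) = X z * X w ^ n" for z w n
    by (simp add: X_def scale_exp add_exp monomial_add monomial_scale)
  have Y_add: "Y (z + n *s w) = Y z * Y w ^ n" for z w n
    by (simp add: Y_def scale_exp add_exp monomial_add monomial_scale)
  have "X e - Y f \<in> J"
    by (rule gen) (simp add: X_def Y_def gluing_generators_def)
  then have "(\<Sum>i<k. Y f ^ (k - Suc i) * X e ^ i) * (X e - Y f) \<in> J" by (rule mult)
  then have power: "X e ^ k - Y f ^ k \<in> J"
    by (simp add: power_diff_sumr2 mult.commute)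
  have "Y y * (X x - X (x' + k *s e)) + X x' * Y y * (X e ^ k - Y f ^ k)
      + - X x' * (Y y' - Y (y + k *s f)) \<in> J"
    using left[OF x] right[OF y] power by (intro add mult) (simp_all add: X_def Y_def)
  moreover have "Y y * (X x - X (x' + k *s e)) + X x' * Y y * (X e ^ k - Y f ^ k)
      + - X x' * (Y y' - Y (y + k *s f)) = X x * Y y - X x' * Y y'"
    by (simp add: X_add Y_add algebra_simps)
  ultimately show ?thesis
    by (simp add: X_def Y_def monomial_add J_def)
qed

text \<open>
  The coordinate functional of the coset of \<open>x\<close> modulo the multiples of the degree of \<open>e\<close>. The second
  group of variables has degree \<open>0\<close> here, and trading \<open>e\<close> for \<open>f\<close> changes this partial degree by the
  degree of \<open>e\<close>, which preserves cosets.
\<close>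

lemma coset_functional_gluing_ideal:
  fixes s :: "'n::finite \<Rightarrow> nat ^ 'd::finite" and t :: "'m::finite \<Rightarrow> nat ^ 'd"
    and p :: "('n + 'm, 'k::field) mpoly" and e :: "nat ^ 'n" and x :: "int ^ 'd"
  defines "F \<equiv> (\<lambda>h. of_bool (\<exists>k. int_vec (degree (case_sum s (\<lambda>_. 0)) h) = x + k *s int_vec (degree s e)))
    :: nat ^ ('n + 'm) \<Rightarrow> ('d, 'k) mpoly"
  assumes "p \<in> ideal_generated (gluing_generators s t e f)"
  shows "lin_ext F p = 0"
proof (rule lin_ext_gluing_ideal_eq_0[OF _ _ _ assms(2)])
  show "\<exists>G. \<forall>e'. F (h + left_exp e') = G (degree s e')" for h
    by (rule exI[of _ "\<lambda>w. of_bool (\<exists>k. int_vec (degree (case_sum s (\<lambda>_. 0)) h + w)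
          = x + k *s int_vec (degree s e))"])
      (simp add: F_def degree_add)
  show "\<exists>G. \<forall>f'. F (h + right_exp f') = G (degree t f')" for h
    by (rule exI[of _ "\<lambda>_. F h"]) (simp add: F_def degree_add)
  have shift: "(\<exists>k. y + z = x + k *s z) \<longleftrightarrow> (\<exists>k. y = x + k *s z)" for y z :: "int ^ 'd"
  proof safe
    fix k assume "y + z = x + k *s z"
    then have "y = x + (k - 1) *s z" by (simp add: vec_eq_iff algebra_simps)
    then show "\<exists>k. y = x + k *s z" ..
  next
    fix k
    have "x + k *s z + z = x + (k + 1) *s z" by (simp add: vec_eq_iff algebra_simps)
    then show "\<exists>l. x + k *s z + z = x + l *s z" ..
  qed
  show "F (h + left_exp e) = F (h + right_exp f)" for h
    by (simp add: F_def degree_add int_vec_add shift)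
qed

lemma ker_eq_gluing_ideal_iff:
  fixes s :: "'n::finite \<Rightarrow> nat ^ 'd::finite" and t :: "'m::finite \<Rightarrow> nat ^ 'd"
  assumes g: "degree s e = degree t f"
  shows "ker (subst (\<lambda>v. monomial (case_sum s t v)) :: ('n + 'm, 'k::field) mpoly \<Rightarrow> ('d, 'k) mpoly)
      = ideal_generated (gluing_generators s t e f) \<longleftrightarrow>
    range (\<lambda>k. k *s int_vec (degree s e)) = Grp (range (degree s)) \<inter> Grp (range (degree t))"
    (is "?K = ?J \<longleftrightarrow> ?Z = ?G")
proof
  assume eq: "?K = ?J"
  show "?Z = ?G"
  proof
    show "?Z \<subseteq> ?G"
      using multiple_in_Grp[of _ s e] multiple_in_Grp[of _ t f] g by auto
    show "?G \<subseteq> ?Z"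
    proof
      fix z assume "z \<in> ?G"
      then obtain x x' y y' where z: "z = int_vec (degree s x) - int_vec (degree s x')"
          "z = int_vec (degree t y') - int_vec (degree t y)"
        unfolding Grp_def by blast
      then have "int_vec (degree s x + degree t y) = int_vec (degree s x' + degree t y')"
        by (simp add: int_vec_add algebra_simps)
      then have deg: "degree s x + degree t y = degree s x' + degree t y'"
        by (simp only: int_vec_eq_iff)
      define p :: "('n + 'm, 'k) mpoly"
        where "p = monomial (left_exp x' + right_exp y') - monomial (left_exp x + right_exp y)"
      have "p \<in> ?K"
        using deg by (simp add: p_def ker_def subst_eq_lin_ext lin_ext_diff lin_ext_monomial degree_add)
      then have p: "p \<in> ?J" using eq by simp
      \<comment> \<open>The functional of the coset of the degree of \<open>x'\<close> is \<open>1\<close> on the first monomial of \<open>p\<close> and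
        kills \<open>p\<close>, so it is \<open>1\<close> on the second one.\<close>
      have "\<exists>k. int_vec (degree s x) = int_vec (degree s x') + k *s int_vec (degree s e)"
      proof (rule ccontr)
        assume *: "\<not> ?thesis"
        have self: "\<exists>k. int_vec (degree s x') = int_vec (degree s x') + k *s int_vec (degree s e)"
          by (rule exI[of _ 0]) (simp add: vec_eq_iff)
        show False
          using coset_functional_gluing_ideal[OF p, of "int_vec (degree s x')"] * self
          by (simp add: p_def lin_ext_diff lin_ext_monomial degree_add)
      qed
      then show "z \<in> ?Z" using z(1) by auto
    qed
  qed
next
  assume eq: "?Z = ?G"
  show "?K = ?J"
  proof
    show "?J \<subseteq> ?K" by (rule gluing_ideal_subset_ker[OF g])
    \<comment> \<open>The case in which the multiple of the common degree is nonnegative; the other one arises by exchanging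
      the two monomials.\<close>
    have key: "monomial (left_exp x + right_exp y) - monomial (left_exp x' + right_exp y') \<in> ?J"
      if deg: "degree s x + degree t y = degree s x' + degree t y'"
        and k: "int_vec (degree s x) - int_vec (degree s x') = int k *s int_vec (degree s e)"
      for x x' y y' k
    proof (rule binomial_in_gluing_ideal)
      have "int_vec (degree s x) = int_vec (degree s (x' + k *s e))"
        using k by (simp add: degree_add degree_scale int_vec_add int_vec_scale algebra_simps)
      then show x: "degree s x = degree s (x' + k *s e)" by simp
      show "degree t y' = degree t (y + k *s f)"
        using deg by (simp add: x degree_add degree_scale g vec_eq_iff algebra_simps)
    qed
    show "?K \<subseteq> ?J"
    proof (rule ker_subset_if_binomials)
      fix h h' :: "nat ^ ('n + 'm)"
      assume h: "degree (case_sum s t) h = degree (case_sum s t) h'"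
      obtain x y where xy: "h = left_exp x + right_exp y" using exp_eq_left_right by blast
      obtain x' y' where xy': "h' = left_exp x' + right_exp y'" using exp_eq_left_right by blast
      have deg: "degree s x + degree t y = degree s x' + degree t y'"
        using h by (simp add: xy xy' degree_add)
      then have "int_vec (degree s x + degree t y) = int_vec (degree s x' + degree t y')" by simp
      then have "int_vec (degree s x) - int_vec (degree s x') = int_vec (degree t y') - int_vec (degree t y)"
        by (simp add: int_vec_add algebra_simps)
      then have "int_vec (degree s x) - int_vec (degree s x') \<in> ?G"
        unfolding Grp_def by blast
      then obtain k where k: "int_vec (degree s x) - int_vec (degree s x') = k *s int_vec (degree s e)"
        using eq by blast
      show "monomial h - monomial h' \<in> ?J"
      proof (cases "k \<ge> 0")
        case True
        then show ?thesis using key[OF deg, of "nat k"] k by (simp add: xy xy')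
      next
        case False
        have "int_vec (degree s x') - int_vec (degree s x) = - (k *s int_vec (degree s e))"
          by (simp flip: k)
        also have "\<dots> = int (nat (- k)) *s int_vec (degree s e)"
          using False by (simp add: vec_eq_iff)
        finally have "monomial h' - monomial h \<in> ?J"
          unfolding xy xy' by (rule key[OF deg[symmetric]])
        then have "- (monomial h' - monomial h) \<in> ?J" by (rule ideal_neg)
        then show ?thesis by simp
      qed
    qed
  qed
qed

theorem theorem5p3:
  fixes S1 S2 :: "(nat ^ 'd::finite) set"
    and s :: "'n::finite \<Rightarrow> nat ^ 'd" and t :: "'m::finite \<Rightarrow> nat ^ 'd"
  assumes "affine_semigroup S1" and "positive_semigroup S1"
    and "affine_semigroup S2" and "positive_semigroup S2"
    and "S1 = submonoid hull range s" and "S2 = submonoid hull range t"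
  shows "can_be_glued TYPE('k::field) s t \<longleftrightarrow>
    (\<exists>a b :: nat. \<exists>g \<in> (*s) a ` S1 \<inter> (*s) b ` S2. g \<noteq> 0 \<and>
      range (\<lambda>k. k *s int_vec g) = Grp ((*s) a ` S1) \<inter> Grp ((*s) b ` S2))"
proof -
  define A where "A a = degree (\<lambda>i. a *s s i)" for a
  define B where "B b = degree (\<lambda>j. b *s t j)" for b
  have S: "(*s) a ` S1 = range (A a)" "(*s) b ` S2 = range (B b)" for a b
    using assms(5,6) by (simp_all add: submonoid_hull_range scale_image_range_degree A_def B_def)
  have fold_case: "case_sum (\<lambda>i. monomial (s' i)) (\<lambda>j. monomial (t' j)) =
      (\<lambda>v. monomial (case_sum s' t' v) :: ('d, 'k) mpoly)"
    for s' :: "'n \<Rightarrow> nat ^ 'd" and t' :: "'m \<Rightarrow> nat ^ 'd"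
    by (rule ext) (simp split: sum.split)
  have monomial_eq_iff: "monomial x = (monomial y :: ('d, 'k) mpoly) \<longleftrightarrow> x = y" for x y
    unfolding monomial_def by (metis Poly_Mapping.lookup_single_eq lookup_single_not_eq zero_neq_one)
  have monomial_eq_1_iff: "monomial x = (1 :: ('d, 'k) mpoly) \<longleftrightarrow> x = 0" for x
    using monomial_eq_iff[of x 0] by simp
  have "can_be_glued TYPE('k) s t \<longleftrightarrow> (\<exists>a b. a > 0 \<and> b > 0 \<and> (\<exists>e f. A a e = B b f \<and> A a e \<noteq> 0 \<and>
      ker (subst (\<lambda>v. monomial (case_sum (\<lambda>i. a *s s i) (\<lambda>j. b *s t j) v)) :: ('n + 'm, 'k) mpoly \<Rightarrow> ('d, 'k) mpoly)
        = ideal_generated (gluing_generators (\<lambda>i. a *s s i) (\<lambda>j. b *s t j) e f)))"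
    unfolding can_be_glued_def Let_def gluing_generators_def ideal_generated_Un fold_case
      include_left_monomial include_right_monomial subst_monomial degree_left_exp degree_right_exp
      sum.case monomial_eq_iff monomial_eq_1_iff A_def B_def ..
  also have "\<dots> \<longleftrightarrow> (\<exists>a b. a > 0 \<and> b > 0 \<and> (\<exists>e f. A a e = B b f \<and> A a e \<noteq> 0 \<and>
      range (\<lambda>k. k *s int_vec (A a e)) = Grp (range (A a)) \<inter> Grp (range (B b))))"
    unfolding A_def B_def by (intro ex_cong1 conj_cong refl ker_eq_gluing_ideal_iff)
  \<comment> \<open>A nonzero common element forces both factors to be positive.\<close>
  also have "\<dots> \<longleftrightarrow> (\<exists>a b. \<exists>e f. A a e = B b f \<and> A a e \<noteq> 0 \<and>
      range (\<lambda>k. k *s int_vec (A a e)) = Grp (range (A a)) \<inter> Grp (range (B b)))"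
  proof -
    have "a > 0" if "A a e \<noteq> 0" for a e
      using that by (cases "a = 0") (auto simp: A_def degree_scale_weights vec_eq_iff)
    moreover have "b > 0" if "B b f \<noteq> 0" for b f
      using that by (cases "b = 0") (auto simp: B_def degree_scale_weights vec_eq_iff)
    ultimately show ?thesis by metis
  qed
  also have "\<dots> \<longleftrightarrow> (\<exists>a b. \<exists>g \<in> range (A a) \<inter> range (B b). g \<noteq> 0 \<and>
      range (\<lambda>k. k *s int_vec g) = Grp (range (A a)) \<inter> Grp (range (B b)))"
    by (intro ex_cong1) (auto 0 3 simp: Bex_def image_iff)
  finally show ?thesis unfolding S .
qed

end
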